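(* Let $f_k=\prod_{j=1}^{\infty}(1-q^{kj})$ and let $p_8(n)$ be defined by $\sum_{n\ge0}p_8(n)q^n=1/f_1^8$. Then \[\sum_{n=0}^{\infty}p_8(2n+1)q^n = 8\frac{f_2^{16}}{f_1^{24}},\qquad \sum_{n=0}^{\infty}p_8(4n+3)q^n = 192\frac{f_2^{24}}{f_1^{32}} + 16384\, q\, \frac{f_2^{48}}{f_1^{56}}.\] *)

theory Defs
  imports "HOL-Analysis.Analysis" "HOL-Computational_Algebra.Formal_Power_Series"
begin

text \<open>
  The identities are read in the ring of formal power series over the rationals, with
  \<open>q\<close> being \<^term>\<open>fps_X\<close>. The infinite product is the limit of the partial products in the
  metric topology on \<open>fps\<close>; the index \<open>j\<close> runs from \<open>0\<close>, hence the shift.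
\<close>

definition eulerf :: "nat \<Rightarrow> rat fps" where
  "eulerf k = (\<Prod>j. 1 - fps_X ^ (k * (j + 1)))"

definition p8 :: "nat \<Rightarrow> rat" where
  "p8 n = fps_nth (1 / eulerf 1 ^ 8) n"

text \<open>For \<open>k = 0\<close> every factor vanishes; for \<open>k > 0\<close> the product converges to a unit.\<close>

lemma eulerf_partial_nth:
  fixes k :: nat
  assumes "k > 0" "n \<le> m"
  shows "fps_nth (\<Prod>j\<le>m. 1 - fps_X ^ (k * (j + 1)) :: rat fps) n =
         fps_nth (\<Prod>j\<le>n. 1 - fps_X ^ (k * (j + 1)) :: rat fps) n"
  using assms(2)
proof (induction m rule: dec_induct)
  case base
  show ?case ..
next
  case (step m)
  have "m + 2 \<le> k * (m + 2)"
    using mult_le_mono1[of 1 k "m + 2"] \<open>k > 0\<close> by (simp only: Suc_leI One_nat_def) simp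
  hence "n < k * (m + 2)"
    using step.hyps by linarith
  thus ?case
    using step.IH by (simp add: right_diff_distrib fps_X_power_mult_right_nth)
qed

lemma eulerf_has_prod:
  assumes "k > 0"
  shows "(\<lambda>j. 1 - fps_X ^ (k * (j + 1))) has_prod eulerf k"
    and "fps_nth (eulerf k) 0 = 1"
proof -
  define P :: "nat \<Rightarrow> rat fps" where "P = (\<lambda>m. \<Prod>j\<le>m. 1 - fps_X ^ (k * (j + 1)))"
  define L where "L = Abs_fps (\<lambda>n. fps_nth (P n) n)"
  have "P \<longlonglongrightarrow> L"
  proof (rule tendsto_fpsI)
    fix n
    have "fps_nth (P m) n = fps_nth L n" if "m \<ge> n" for m
      using eulerf_partial_nth[OF assms that] by (simp add: P_def L_def)
    thus "\<forall>\<^sub>F m in sequentially. fps_nth (P m) n = fps_nth L n"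
      by (auto simp: eventually_at_top_linorder)
  qed
  moreover have L0: "fps_nth L 0 = 1"
    using assms by (simp add: L_def P_def)
  hence "L \<noteq> 0"
    by auto
  ultimately have "raw_has_prod (\<lambda>j. 1 - fps_X ^ (k * (j + 1))) 0 L"
    by (simp add: raw_has_prod_def P_def)
  hence *: "(\<lambda>j. 1 - fps_X ^ (k * (j + 1))) has_prod L"
    by (simp add: has_prod_def)
  hence "eulerf k = L"
    unfolding eulerf_def by (rule has_prod_unique [symmetric])
  with * L0 show "(\<lambda>j. 1 - fps_X ^ (k * (j + 1))) has_prod eulerf k" "fps_nth (eulerf k) 0 = 1"
    by simp_all
qed

end

theory Submission
  imports Defs "HOL-Computational_Algebra.Formal_Laurent_Series"
begin

text \<open>
  Put \<open>g = f\<^sub>1(-q)\<close>. Everything follows from Jacobi's identity \<open>g\<^sup>8 - f\<^sub>1\<^sup>8 = 16 q f\<^sub>4\<^sup>8\<close> together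
  with \<open>f\<^sub>1 g f\<^sub>4 = f\<^sub>2\<^sup>3\<close>: for \<open>G = 1/f\<^sub>1\<^sup>8\<close> and \<open>G' = G(-q)\<close> they give
  \<open>D = G - G' = 16 q f\<^sub>4\<^bsup>16\<^esup> / f\<^sub>2\<^bsup>24\<^esup>\<close> and \<open>G G' = f\<^sub>4\<^sup>8 / f\<^sub>2\<^bsup>24\<^esup>\<close>, where \<open>D\<close> is twice the
  odd part of \<open>G\<close>; this is the first formula, and the second one comes from
  \<open>G\<^sup>3 - G'\<^sup>3 = D (D\<^sup>2 + 3 G G')\<close>.

  Jacobi's identity is \<open>\<phi>(q)\<^sup>4 - \<phi>(-q)\<^sup>4 = 16 q \<psi>(q\<^sup>2)\<^sup>4\<close> in disguise. It is obtained from
  \<open>\<phi>(q)\<^sup>2 = \<phi>(q\<^sup>2)\<^sup>2 + 4 q \<psi>(q\<^sup>4)\<^sup>2\<close> (rotate the lattice of pairs \<open>(x, y)\<close> in \<open>x\<^sup>2 + y\<^sup>2\<close> by 45 degrees,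
  splitting by the parity of \<open>x + y\<close>) and the product formulas for \<open>\<phi>\<close> and \<open>\<psi>\<close>, which are the
  limits of a finite triple product identity, an instance of the \<open>q\<close>-binomial theorem.
\<close>

unbundle no vec_syntax
unbundle fps_syntax

section \<open>Limits of formal power series\<close>

text \<open>Convergence means that each coefficient is eventually constant, and finitely many such
  events eventually hold together. This suffices for products and compositions, whose coefficient at
  \<open>m\<close> only involves the coefficients of \<open>f\<close> up to
  \<open>m\<close>.\<close>

lemma fps_tendsto_nth_le:
  assumes "(f \<longlongrightarrow> (A :: 'a :: group_add fps)) F"
  shows "\<forall>\<^sub>F x in F. \<forall>i\<le>m. f x $ i = A $ i"
proof -
  have "\<forall>\<^sub>F x in F. \<forall>i\<in>{..m}. f x $ i = A $ i"
    using assms by (intro eventually_ball_finite) (auto simp: tendsto_fps_iff)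
  thus ?thesis by (simp add: Ball_def)
qed

lemma fps_tendsto_mult:
  fixes A B :: "'a :: ring fps"
  assumes "(f \<longlongrightarrow> A) F" "(g \<longlongrightarrow> B) F"
  shows "((\<lambda>x. f x * g x) \<longlongrightarrow> A * B) F"
proof (rule tendsto_fpsI)
  fix m
  show "\<forall>\<^sub>F x in F. (f x * g x) $ m = (A * B) $ m"
    using fps_tendsto_nth_le[OF assms(1), of m] fps_tendsto_nth_le[OF assms(2), of m]
    by eventually_elim (simp add: fps_mult_nth)
qed

text \<open>This replaces continuity of division: \<open>g x\<close> eventually has the constant
  term of \<open>B\<close>, hence is a unit, and \<open>(f x - A) * g x\<close> vanishes up to
  degree \<open>m\<close>, so dividing by \<open>g x\<close> keeps it zero there.\<close>

lemma fps_tendsto_mult_cancel: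
  fixes A B :: "'a :: field fps"
  assumes "((\<lambda>x. f x * g x) \<longlongrightarrow> A * B) F" "(g \<longlongrightarrow> B) F" "B $ 0 \<noteq> 0"
  shows "(f \<longlongrightarrow> A) F"
proof (rule tendsto_fpsI)
  fix m
  show "\<forall>\<^sub>F x in F. f x $ m = A $ m"
    using fps_tendsto_nth_le[OF assms(1), of m] fps_tendsto_nth_le[OF assms(2), of m]
  proof eventually_elim
    case (elim x)
    have unit: "g x $ 0 \<noteq> 0" using elim(2) assms(3) by simp
    have "((f x - A) * g x) $ i = 0" if "i \<le> m" for i
    proof -
      have "(A * g x) $ i = (A * B) $ i"
        using elim(2) that by (simp add: fps_mult_nth)
      thus ?thesis using elim(1) that by (simp add: left_diff_distrib)
    qed
    hence "((f x - A) * g x * inverse (g x)) $ m = 0"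
      by (subst fps_mult_nth) simp
    moreover have "(f x - A) * g x * inverse (g x) = f x - A"
      using inverse_mult_eq_1'[OF unit] by (simp add: mult.assoc)
    ultimately show ?case by simp
  qed
qed

lemma fps_tendsto_compose:
  fixes A :: "'a :: ring_1 fps"
  assumes "(f \<longlongrightarrow> A) F"
  shows "((\<lambda>x. f x oo c) \<longlongrightarrow> A oo c) F"
proof (rule tendsto_fpsI)
  fix m
  show "\<forall>\<^sub>F x in F. (f x oo c) $ m = (A oo c) $ m"
    using fps_tendsto_nth_le[OF assms, of m]
    by eventually_elim (simp add: fps_compose_nth)
qed

section \<open>Gaussian binomial coefficients and the q-binomial theorem\<close>

definition qpoch :: "'a :: comm_ring_1 \<Rightarrow> nat \<Rightarrow> 'a" where
  "qpoch q n = (\<Prod>i<n. 1 - q ^ (i + 1))"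

text \<open>The Gaussian binomial coefficient, given by a q-Pascal rule instead of a quotient so
  that it makes sense for every \<open>q\<close> in a commutative ring.\<close>

fun qbinom :: "'a :: comm_ring_1 \<Rightarrow> nat \<Rightarrow> nat \<Rightarrow> 'a" where
  "qbinom q n 0 = 1"
| "qbinom q 0 (Suc k) = 0"
| "qbinom q (Suc n) (Suc k) = qbinom q n (Suc k) + q ^ (n - k) * qbinom q n k"

lemma qbinom_eq_0: "n < k \<Longrightarrow> qbinom q n k = 0"
  by (induction q n k rule: qbinom.induct) auto

lemma qpoch_0 [simp]: "qpoch q 0 = 1" by (simp add: qpoch_def)

lemma qpoch_Suc: "qpoch q (Suc n) = qpoch q n * (1 - q ^ (n + 1))" by (simp add: qpoch_def)

text \<open>The quotient formula with denominators cleared. With \<open>d = n - k - 1\<close> the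
  recursion reduces to \<open>(1 - q^(d+1)) + q^(d+1) * (1 - q^(k+1)) = 1 - q^(n+1)\<close>.\<close>

lemma qbinom_qpoch: "k \<le> n \<Longrightarrow> qbinom q n k * qpoch q k * qpoch q (n - k) = qpoch q n"
proof (induction q n k rule: qbinom.induct)
  case (3 q n k)
  show ?case
  proof (cases "k = n")
    case True
    with 3 show ?thesis by (simp add: qbinom_eq_0 qpoch_Suc mult.assoc [symmetric])
  next
    case False
    with 3 have k: "k < n" by simp
    then obtain d where d: "n = Suc (k + d)" using less_imp_Suc_add by blast
    have 1: "qbinom q n (Suc k) * qpoch q (Suc k) * qpoch q d = qpoch q n"
      using 3(1) d by simp
    have 2: "qbinom q n k * qpoch q k * qpoch q (Suc d) = qpoch q n"
      using 3(2) d by (simp add: Suc_diff_le)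
    have "qbinom q (Suc n) (Suc k) * qpoch q (Suc k) * qpoch q (Suc d)
        = (qbinom q n (Suc k) * qpoch q (Suc k) * qpoch q d) * (1 - q ^ (d + 1))
          + q ^ (d + 1) * (1 - q ^ (k + 1)) * (qbinom q n k * qpoch q k * qpoch q (Suc d))"
      using d by (simp add: qpoch_Suc algebra_simps)
    also have "\<dots> = qpoch q (Suc n)"
      unfolding 1 2 using d by (simp add: qpoch_Suc algebra_simps power_add)
    finally show ?thesis using d by (simp add: Suc_diff_le)
  qed
qed simp_all

text \<open>Induction on \<open>n\<close>: multiplying by the last factor
  \<open>x + y * q ^ n\<close> sends the terms \<open>k + 1\<close> and \<open>k\<close> to the new
  term \<open>k + 1\<close>, where they combine by the q-Pascal rule.\<close>

lemma qbinomial_theorem: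
  fixes q x y :: "'a :: comm_ring_1"
  shows "(\<Prod>i<n. x + y * q ^ i) = (\<Sum>k\<le>n. q ^ (k choose 2) * qbinom q n k * x ^ (n - k) * y ^ k)"
proof (induction n)
  case (Suc n)
  define t where "t k = q ^ (k choose 2) * qbinom q n k * x ^ (n - k) * y ^ k" for k
  have step: "q ^ (Suc k choose 2) * qbinom q (Suc n) (Suc k) * x ^ (Suc n - Suc k) * y ^ Suc k
      = t (Suc k) * x + t k * (y * q ^ n)" if "k \<le> n" for k
  proof -
    have c: "Suc k choose 2 = k + (k choose 2)"
      by (simp add: numeral_2_eq_2)
    have "t (Suc k) * x = q ^ (Suc k choose 2) * qbinom q n (Suc k) * x ^ (n - k) * y ^ Suc k"
    proof (cases "k = n")
      case False
      with that have "n - k = Suc (n - Suc k)" by simp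
      thus ?thesis by (simp add: t_def algebra_simps)
    qed (simp add: t_def qbinom_eq_0)
    moreover have "t k * (y * q ^ n)
        = q ^ (Suc k choose 2) * (q ^ (n - k) * qbinom q n k) * x ^ (n - k) * y ^ Suc k"
    proof -
      have "q ^ n = q ^ k * q ^ (n - k)"
        using that by (simp flip: power_add)
      thus ?thesis unfolding c by (simp add: t_def power_add algebra_simps)
    qed
    ultimately show ?thesis by (simp add: algebra_simps)
  qed
  have "(\<Prod>i<Suc n. x + y * q ^ i) = (\<Sum>k\<le>n. t k) * (x + y * q ^ n)"
    using Suc.IH by (simp add: t_def)
  also have "\<dots> = (\<Sum>k\<le>n. t k) * x + (\<Sum>k\<le>n. t k * (y * q ^ n))"
    by (simp add: distrib_left sum_distrib_right)
  \<comment> \<open>The added term is zero because \<open>qbinom q n (Suc n) = 0\<close>; it aligns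
    the two sums after the index shift.\<close>
  also have "(\<Sum>k\<le>n. t k) = (\<Sum>k\<le>Suc n. t k)"
    by (simp add: t_def qbinom_eq_0)
  also have "\<dots> * x = t 0 * x + (\<Sum>k\<le>n. t (Suc k) * x)"
    by (subst sum.atMost_Suc_shift) (simp add: distrib_right sum_distrib_right)
  also have "\<dots> + (\<Sum>k\<le>n. t k * (y * q ^ n))
      = t 0 * x + (\<Sum>k\<le>n. t (Suc k) * x + t k * (y * q ^ n))"
    by (simp add: sum.distrib)
  also have "(\<Sum>k\<le>n. t (Suc k) * x + t k * (y * q ^ n)) = (\<Sum>k\<le>n. 
      q ^ (Suc k choose 2) * qbinom q (Suc n) (Suc k) * x ^ (Suc n - Suc k) * y ^ Suc k)"
    by (intro sum.cong refl step [symmetric]) simp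
  also have "t 0 * x + \<dots> = (\<Sum>k\<le>Suc n. q ^ (k choose 2) * qbinom q (Suc n) k * x ^ (Suc n - k) * y ^
      k)"
    by (subst sum.atMost_Suc_shift) (simp add: t_def mult_ac numeral_2_eq_2)
  finally show ?case .
qed (simp add: numeral_2_eq_2)

section \<open>The finite triple product and theta series as its limit\<close>

text \<open>For \<open>a = 1\<close> this is a product of two consecutive integers. It ensures that
  \<open>nat\<close> does not truncate the exponents below.\<close>

lemma square_add_linear_nonneg: "a \<in> {0, 1} \<Longrightarrow> (j::int)\<^sup>2 + int a * j \<ge> 0"
proof -
  assume "a \<in> {0, 1}"
  moreover have "j * (j + 1) \<ge> 0" by (cases "j \<ge> 0") (auto simp: mult_nonpos_nonpos)
  ultimately show ?thesis by (auto simp: power2_eq_square algebra_simps)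
qed

lemma finite_triple_product:
  fixes a n :: nat
  assumes a: "a \<in> {0, 1}" and n: "n > 0"
  shows "(\<Prod>i<n. 1 + fps_X ^ (2 * i + 1 - a)) * (\<Prod>i<n. 1 + fps_X ^ (2 * i + 1 + a)) =
    (\<Sum>k\<le>2 * n. fps_X ^ nat ((int k - int n)\<^sup>2 + int a * (int k - int n)) *
      qbinom (fps_X\<^sup>2) (2 * n) k :: 'a :: idom fps)" (is "?L = ?R")
proof -
  \<comment> \<open>the \<open>q\<close>-binomial theorem in base \<open>X\<^sup>2\<close> with \<open>x = X ^ (2 * n - 1 - a)\<close> and
      \<open>y = 1\<close>; the common factor \<open>X ^ C\<close> cancels\<close>
  define X :: "'a fps" where "X = fps_X"
  define b where "b = 2 * n - 1 - a"
  have b: "b + 1 + a = 2 * n" using a n by (auto simp: b_def)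
  define e where "e k = nat ((int k - int n)\<^sup>2 + int a * (int k - int n))" for k
  define C where "C = n * (n - 1) + b * n"
  \<comment> \<open>Completing the square around the middle index \<open>k = n\<close>: everything
    independent of \<open>k\<close> goes into \<open>C\<close>.\<close>
  have expo: "2 * (k choose 2) + b * (2 * n - k) = C + e k" if "k \<le> 2 * n" for k
  proof -
    have ch: "2 * (k choose 2) = k * (k - 1)" for k :: nat
      unfolding choose_two by (rule dvd_mult_div_cancel) auto
    have s: "int (k * (k - 1)) = int k * (int k - 1)" for k :: nat
      by (cases k) (auto simp: algebra_simps)
    have "int (e k) = (int k - int n)\<^sup>2 + int a * (int k - int n)"
      unfolding e_def using square_add_linear_nonneg[OF a] by simp
    moreover have ib: "int b = 2 * int n - 1 - int a" using b by linarith
    moreover have "int (b * (2 * n - k)) = int b * (2 * int n - int k)" using that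
        by (simp add: of_nat_diff)
    moreover have "int (b * n) = int b * int n" by simp
    ultimately have "int (k * (k - 1)) + int (b * (2 * n - k)) =
        int (n * (n - 1)) + int (b * n) + int (e k)"
      unfolding s by (simp only: ib) (simp add: power2_eq_square algebra_simps)
    thus ?thesis unfolding ch C_def by linarith
  qed
  have "(\<Prod>i<2 * n. X ^ b + 1 * (X\<^sup>2) ^ i) = (\<Sum>k\<le>2 * n. (X\<^sup>2) ^ (k choose 2) * qbinom (X\<^sup>2) (2 * n) k *
      (X ^ b) ^ (2 * n - k) * 1 ^ k)"
    by (rule qbinomial_theorem)
  also have "\<dots> = (\<Sum>k\<le>2 * n. X ^ C * (X ^ e k * qbinom (X\<^sup>2) (2 * n) k))"
  proof (rule sum.cong)
    fix k assume "k \<in> {..2 * n}"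
    hence "X ^ (2 * (k choose 2)) * X ^ (b * (2 * n - k)) = X ^ C * X ^ e k"
      using expo[of k] by (simp flip: power_add)
    thus "(X\<^sup>2) ^ (k choose 2) * qbinom (X\<^sup>2) (2 * n) k * (X ^ b) ^ (2 * n - k) * 1 ^ k =
        X ^ C * (X ^ e k * qbinom (X\<^sup>2) (2 * n) k)"
      by (simp flip: power_mult add: mult_ac)
  qed simp
  also have "\<dots> = X ^ C * ?R" by (simp add: sum_distrib_left e_def X_def)
  finally have 1: "(\<Prod>i<2 * n. X ^ b + 1 * (X\<^sup>2) ^ i) = X ^ C * ?R" .
  \<comment> \<open>The factors are split at \<open>i = n\<close>: for \<open>i < n\<close> the
    power \<open>X ^ (2 * i)\<close> can be pulled out, for the others \<open>X ^ b\<close>.\<close>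
  have "(\<Prod>i<2 * n. X ^ b + 1 * (X\<^sup>2) ^ i) = (\<Prod>i<n. X ^ b + X ^ (2 * i)) * (\<Prod>i<n. X ^ b + X ^ (2 * (i + n)))"
  proof -
    have "{..<2 * n} = {..<n} \<union> {n..<n + n}" by auto
    moreover have "(\<Prod>i=n..<n + n. X ^ b + X ^ (2 * i)) = (\<Prod>i<n. X ^ b + X ^ (2 * (i + n)))"
      using prod.shift_bounds_nat_ivl[of "\<lambda>i. X ^ b + X ^ (2 * i)" 0 n n]
          by (simp add: atLeast0LessThan)
    ultimately show ?thesis
      by (simp add: prod.union_disjoint ivl_disj_int flip: power_mult)
  qed
  also have "(\<Prod>i<n. X ^ b + X ^ (2 * (i + n))) = X ^ (b * n) * (\<Prod>i<n. 1 + X ^ (2 * i + 1 + a))"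
  proof -
    have "X ^ b + X ^ (2 * (i + n)) = X ^ b * (1 + X ^ (2 * i + 1 + a))" for i
    proof -
      have "2 * (i + n) = b + (2 * i + 1 + a)" using b by simp
      thus ?thesis by (simp only: power_add distrib_left mult_1_right)
    qed
    thus ?thesis by (simp add: prod.distrib power_mult)
  qed
  also have "(\<Prod>i<n. X ^ b + X ^ (2 * i)) = X ^ (n * (n - 1)) * (\<Prod>i<n. 1 + X ^ (2 * i + 1 - a))"
  proof -
    \<comment> \<open>Pulling out \<open>X ^ (2 * i)\<close> yields the wanted factors in reverse
      order.\<close>
    have "(\<Prod>i<n. X ^ b + X ^ (2 * i)) = (\<Prod>i<n. X ^ (2 * i) * (1 + X ^ (2 * (n - Suc i) + 1 - a)))"
    proof (rule prod.cong)
      fix i assume "i \<in> {..<n}"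
      hence "b = 2 * i + (2 * (n - Suc i) + 1 - a)" using b a by auto
      hence "X ^ b = X ^ (2 * i) * X ^ (2 * (n - Suc i) + 1 - a)" by (metis power_add)
      thus "X ^ b + X ^ (2 * i) = X ^ (2 * i) * (1 + X ^ (2 * (n - Suc i) + 1 - a))"
        by (simp add: distrib_left)
    qed simp
    also have "\<dots> = (\<Prod>i<n. X ^ (2 * i)) * (\<Prod>i<n. 1 + X ^ (2 * i + 1 - a))"
      using prod.nat_diff_reindex[of "\<lambda>i. 1 + X ^ (2 * i + 1 - a)" n] by (simp add: prod.distrib)
    also have "(\<Prod>i<n. X ^ (2 * i)) = X ^ (n * (n - 1))"
    proof -
      have "(\<Prod>i<n. X ^ (2 * i)) = X ^ (\<Sum>i<n. 2 * i)" by (simp add: power_sum)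
      also have "(\<Sum>i<n. 2 * i) = n * (n - 1)"
        proof (induct n)
          case (Suc n)
          thus ?case by (cases n) simp_all
        qed simp
      finally show ?thesis .
    qed
    finally show ?thesis .
  qed
  finally have "X ^ C * ?L = X ^ C * ?R"
    unfolding 1 C_def by (simp add: X_def power_add mult_ac)
  thus ?thesis by (simp add: X_def)
qed

text \<open>In Ramanujan's notation, \<open>theta 0 = \<phi>(q)\<close> and \<open>theta 1 = 2 \<psi>(q\<^sup>2)\<close>.\<close>

definition theta :: "nat \<Rightarrow> rat fps" where
  "theta a = Abs_fps (\<lambda>m. of_nat (card {j :: int. j\<^sup>2 + int a * j = int m}))"

text \<open>A crude bound, enough to make the solution sets finite and to confine the exponents up
  to \<open>m\<close> to a window around \<open>j = 0\<close>.\<close>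

lemma abs_le_square_add_linear:
  assumes "a \<in> {0, 1 :: nat}" "(j::int)\<^sup>2 + int a * j \<le> int m"
  shows "\<bar>j\<bar> \<le> int m + 1"
proof -
  have "\<bar>j\<bar> \<le> j\<^sup>2"
    using self_le_power[of "\<bar>j\<bar>" 2] by (cases "j = 0") auto
  moreover have "\<bar>j\<bar> - 1 \<le> j\<^sup>2 + j"
  proof (cases "j \<ge> 0")
    case False
    hence "(j + 1) * (j + 1) \<ge> 0" "j \<le> -1" by auto
    thus ?thesis using False by (simp add: power2_eq_square algebra_simps)
  next
    case True
    thus ?thesis using zero_le_power2[of j] by linarith
  qed
  ultimately show ?thesis using assms by auto
qed

lemma eulerf_nth_0: "k > 0 \<Longrightarrow> eulerf k $ 0 = 1"
  by (rule eulerf_has_prod(2))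

lemma eulerf_nonzero: "k > 0 \<Longrightarrow> eulerf k \<noteq> 0"
  using eulerf_nth_0[of k] by auto

lemma qpoch_tendsto_eulerf:
  assumes "k > 0"
  shows "(\<lambda>n. qpoch (fps_X ^ k) n) \<longlonglongrightarrow> eulerf k"
proof -
  let ?f = "\<lambda>j. 1 - fps_X ^ (k * (j + 1)) :: rat fps"
  have "(\<lambda>n. \<Prod>j\<le>n. ?f j) \<longlonglongrightarrow> eulerf k"
  proof (rule has_prod_imp_tendsto)
    show "?f has_prod eulerf k" by (rule eulerf_has_prod(1)[OF assms])
  qed
  hence "(\<lambda>n. qpoch (fps_X ^ k) (Suc n)) \<longlonglongrightarrow> eulerf k"
    unfolding qpoch_def lessThan_Suc_atMost power_mult .
  thus ?thesis by (rule LIMSEQ_imp_Suc)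
qed

text \<open>By the quotient formula the limit is \<open>eulerf k / eulerf k ^ 2\<close> times
  \<open>eulerf k\<close>. The two indices tend to infinity independently because they are later
  instantiated with \<open>k\<close> and \<open>2 * n - k\<close>.\<close>

lemma qbinom_tendsto:
  assumes k: "k > 0"
  shows "((\<lambda>(r, s). qbinom (fps_X ^ k) (r + s) r * eulerf k) \<longlongrightarrow> 1) (sequentially \<times>\<^sub>F sequentially)"
proof -
  let ?Q = "fps_X ^ k :: rat fps" and ?F = "sequentially \<times>\<^sub>F sequentially :: (nat \<times> nat) filter"
  have r: "((\<lambda>p. qpoch ?Q (fst p)) \<longlongrightarrow> eulerf k) ?F"
    by (rule filterlim_compose[OF qpoch_tendsto_eulerf[OF k] filterlim_fst])
  have s: "((\<lambda>p. qpoch ?Q (snd p)) \<longlongrightarrow> eulerf k) ?F"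
    by (rule filterlim_compose[OF qpoch_tendsto_eulerf[OF k] filterlim_snd])
  have "filterlim (\<lambda>p :: nat \<times> nat. fst p + snd p) sequentially ?F"
    by (rule filterlim_at_top_mono[OF filterlim_fst]) (simp add: always_eventually)
  hence rs: "((\<lambda>p. qpoch ?Q (fst p + snd p)) \<longlongrightarrow> eulerf k) ?F"
    by (rule filterlim_compose[OF qpoch_tendsto_eulerf[OF k]])
  have eq: "qpoch ?Q (fst p + snd p) * eulerf k =
      (qbinom ?Q (fst p + snd p) (fst p) * eulerf k) * (qpoch ?Q (fst p) * qpoch ?Q (snd p))" for p
    using qbinom_qpoch[of "fst p" "fst p + snd p" ?Q] by (simp add: mult_ac)
  have "((\<lambda>p. qpoch ?Q (fst p + snd p) * eulerf k) \<longlongrightarrow> eulerf k * eulerf k) ?F"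
    by (intro fps_tendsto_mult rs tendsto_const)
  hence "((\<lambda>p. (qbinom ?Q (fst p + snd p) (fst p) * eulerf k) * (qpoch ?Q (fst p) * qpoch ?Q (snd
      p)))
      \<longlongrightarrow> 1 * (eulerf k * eulerf k)) ?F"
    by (simp only: eq mult_1)
  hence "((\<lambda>p. qbinom ?Q (fst p + snd p) (fst p) * eulerf k) \<longlongrightarrow> 1) ?F"
    by (rule fps_tendsto_mult_cancel[OF _ fps_tendsto_mult[OF r s]]) (simp add: eulerf_nth_0 k)
  thus ?thesis by (simp add: case_prod_unfold)
qed

lemma triple_product_tendsto_theta:
  assumes a: "a \<in> {0, 1}"
  shows "(\<lambda>n. (\<Prod>i<n. 1 + fps_X ^ (2 * i + 1 - a)) * (\<Prod>i<n. 1 + fps_X ^ (2 * i + 1 + a)) * eulerf 2)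
      \<longlonglongrightarrow> theta a"
proof (rule tendsto_fpsI)
  fix m
  have "\<forall>\<^sub>F p in sequentially \<times>\<^sub>F sequentially. \<forall>i\<le>m. (case p of (r, s) \<Rightarrow> qbinom (fps_X\<^sup>2) (r + s) r *
      eulerf 2) $ i = 1 $ i"
    by (rule fps_tendsto_nth_le[OF qbinom_tendsto]) simp
  then obtain N where N: "\<And>r s i. r \<ge> N \<Longrightarrow> s \<ge> N \<Longrightarrow> i \<le> m \<Longrightarrow>
      (qbinom (fps_X\<^sup>2) (r + s) r * eulerf 2) $ i = 1 $ i"
    unfolding eventually_prod_sequentially by fastforce
  show "\<forall>\<^sub>F n in sequentially. ((\<Prod>i<n. 1 + fps_X ^ (2 * i + 1 - a)) * (\<Prod>i<n. 1 + fps_X ^ (2 * i + 1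
      + a)) * eulerf 2) $ m = theta a $ m"
    \<comment> \<open>If \<open>e k \<le> m\<close> then \<open>k\<close> is within
      \<open>m + 1\<close> of \<open>n\<close>, so both \<open>k\<close> and
      \<open>2 * n - k\<close> are at least \<open>N\<close>. The Gaussian binomial times
      \<open>eulerf 2\<close> then agrees with 1 up to degree \<open>m\<close>.\<close>
    using eventually_ge_at_top[of "N + m + 1"]
  proof eventually_elim
    case (elim n)
    define e where "e k = nat ((int k - int n)\<^sup>2 + int a * (int k - int n))" for k
    have e: "int (e k) = (int k - int n)\<^sup>2 + int a * (int k - int n)" for k
      unfolding e_def using square_add_linear_nonneg[OF a] by simp
    have "((\<Prod>i<n. 1 + fps_X ^ (2 * i + 1 - a)) * (\<Prod>i<n. 1 + fps_X ^ (2 * i + 1 + a)) * eulerf 2) $ m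
        = (\<Sum>k\<le>2 * n. (fps_X ^ e k * (qbinom (fps_X\<^sup>2) (2 * n) k * eulerf 2)) $ m)"
      using elim by (subst finite_triple_product[OF a]) (simp_all add: e_def sum_distrib_right
          fps_sum_nth mult.assoc)
    also have "\<dots> = (\<Sum>k\<le>2 * n. if e k = m then 1 else 0)"
    proof (rule sum.cong)
      fix k assume k: "k \<in> {..2 * n}"
      show "(fps_X ^ e k * (qbinom (fps_X\<^sup>2) (2 * n) k * eulerf 2)) $ m = (if e k = m then 1 else 0)"
      proof (cases "e k \<le> m")
        case True
        hence "\<bar>int k - int n\<bar> \<le> int m + 1"
          using e[of k] by (intro abs_le_square_add_linear[OF a]) simp
        hence "k \<ge> N" "2 * n - k \<ge> N" using elim by linarith+
        thus ?thesis
          using N[of k "2 * n - k" "m - e k"] k True by (auto simp: fps_X_power_mult_nth)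
      qed (simp add: fps_X_power_mult_nth)
    qed simp
    also have "\<dots> = of_nat (card {k \<in> {..2 * n}. e k = m})"
      by (simp add: sum.If_cases Int_def)
    also have "card {k \<in> {..2 * n}. e k = m} = card {j :: int. j\<^sup>2 + int a * j = int m}"
    proof (rule bij_betw_same_card)
      show "bij_betw (\<lambda>k. int k - int n) {k \<in> {..2 * n}. e k = m} {j :: int. j\<^sup>2 + int a * j =
          int m}"
      proof (rule bij_betw_byWitness[where f' = "\<lambda>j. nat (j + int n)"])
        show "(\<lambda>k. int k - int n) ` {k \<in> {..2 * n}. e k = m} \<subseteq> {j. j\<^sup>2 + int a * j = int m}"
          using e by auto
        have b: "\<bar>j\<bar> \<le> int n" if "j\<^sup>2 + int a * j = int m" for j
          using abs_le_square_add_linear[OF a, of j m] that elim by linarith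
        show "\<forall>j\<in>{j. j\<^sup>2 + int a * j = int m}. int (nat (j + int n)) - int n = j"
        proof
          fix j assume "j \<in> {j. j\<^sup>2 + int a * j = int m}"
          hence "\<bar>j\<bar> \<le> int n" using b by blast
          thus "int (nat (j + int n)) - int n = j" by linarith
        qed
        show "(\<lambda>j. nat (j + int n)) ` {j. j\<^sup>2 + int a * j = int m} \<subseteq> {k \<in> {..2 * n}. e k = m}"
        proof
          fix k assume "k \<in> (\<lambda>j. nat (j + int n)) ` {j. j\<^sup>2 + int a * j = int m}"
          then obtain j where j: "k = nat (j + int n)" "j\<^sup>2 + int a * j = int m" by auto
          with b[of j] have "int k - int n = j" "k \<le> 2 * n" by linarith+
          thus "k \<in> {k \<in> {..2 * n}. e k = m}" using j(2) e[of k] by simp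
        qed
      qed auto
    qed
    finally show ?case by (simp add: theta_def)
  qed
qed

section \<open>Product formulas for the theta series\<close>

lemma fps_compose_qpoch:
  fixes c :: "'a :: idom fps"
  assumes "c $ 0 = 0"
  shows "qpoch q n oo c = qpoch (q oo c) n"
  unfolding qpoch_def
  by (simp add: fps_compose_prod_distrib[OF assms] fps_compose_sub_distrib fps_compose_power[OF
      assms] del: power_Suc)

text \<open>One statement for both substitutions used below: \<open>q\<close> to \<open>q^2\<close>
  for every \<open>k\<close>, and \<open>q\<close> to \<open>-q\<close> for even
  \<open>k\<close>.\<close>

lemma eulerf_compose:
  assumes "c $ 0 = 0" "k > 0" "l > 0" "c ^ k = fps_X ^ l"
  shows "eulerf k oo c = eulerf l"
proof (rule LIMSEQ_unique)
  show "(\<lambda>n. qpoch (fps_X ^ k) n oo c) \<longlonglongrightarrow> (eulerf k oo c)"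
    by (intro fps_tendsto_compose qpoch_tendsto_eulerf assms)
  have "qpoch (fps_X ^ k) n oo c = qpoch (fps_X ^ l) n" for n
    using assms by (simp add: fps_compose_qpoch fps_X_power_compose)
  thus "(\<lambda>n. qpoch (fps_X ^ k) n oo c) \<longlonglongrightarrow> eulerf l"
    using qpoch_tendsto_eulerf[OF assms(3)] by simp
qed

lemma eulerf_compose_square: "k > 0 \<Longrightarrow> eulerf k oo fps_X\<^sup>2 = eulerf (2 * k)"
  by (rule eulerf_compose) (simp_all flip: power_mult)

lemma eulerf_compose_uminus: "k > 0 \<Longrightarrow> even k \<Longrightarrow> eulerf k oo - fps_X = eulerf k"
  by (rule eulerf_compose) simp_all

lemma prod_one_plus_tendsto:
  assumes k: "k > 0"
  shows "(\<lambda>n. \<Prod>i<n. 1 + fps_X ^ (k * (i + 1))) \<longlonglongrightarrow> eulerf (2 * k) / eulerf k"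
proof (rule fps_tendsto_mult_cancel)
  show "qpoch (fps_X ^ k) \<longlonglongrightarrow> eulerf k"
    by (rule qpoch_tendsto_eulerf[OF k])
  show nz: "eulerf k $ 0 \<noteq> 0" using k by (simp add: eulerf_nth_0)
  have "(\<Prod>i<n. 1 + fps_X ^ (k * (i + 1))) * qpoch (fps_X ^ k) n =
      (qpoch (fps_X ^ (2 * k)) n :: rat fps)" for n
  proof -
    have "(1 + x) * (1 - x) = 1 - x\<^sup>2" for x :: "rat fps"
      by (simp add: algebra_simps power2_eq_square)
    thus ?thesis
      by (simp add: qpoch_def flip: power_mult prod.distrib del: mult_Suc_right power_Suc) (simp
          add: mult_ac)
  qed
  moreover have "eulerf (2 * k) / eulerf k * eulerf k = eulerf (2 * k)"
    using nz by (simp add: fps_divide_unit mult.assoc inverse_mult_eq_1)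
  ultimately show "(\<lambda>n. (\<Prod>i<n. 1 + fps_X ^ (k * (i + 1))) * qpoch (fps_X ^ k) n) \<longlonglongrightarrow>
      eulerf (2 * k) / eulerf k * eulerf k"
    using qpoch_tendsto_eulerf[of "2 * k"] k by simp
qed

lemma prod_even_odd_split:
  fixes n :: nat
  shows "(\<Prod>i<n. g (2 * i)) * (\<Prod>i<n. g (2 * i + 1)) = (\<Prod>i<2 * n. g i :: 'a :: comm_monoid_mult)"
  by (induct n) (simp_all add: mult_ac)

lemma filterlim_times_2: "filterlim (\<lambda>n::nat. 2 * n) sequentially sequentially"
  by (rule filterlim_subseq) (simp add: strict_mono_def)

text \<open>The closed form of the product of all \<open>1 + q\<^bsup>2i+1\<^esup>\<close>.\<close>

definition odd_prod :: "rat fps" where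
  "odd_prod = eulerf 2 ^ 2 / (eulerf 1 * eulerf 4)"

lemma odd_prod_mult: "odd_prod * (eulerf 1 * eulerf 4) = eulerf 2 ^ 2"
  by (simp add: odd_prod_def fps_divide_unit mult.assoc inverse_mult_eq_1 eulerf_nth_0)

text \<open>The product of all \<open>1 + q^j\<close> is split by the parity of \<open>j\<close>,
  and the limit over even \<open>j\<close> is divided out.\<close>

lemma prod_odd_tendsto: "(\<lambda>n. \<Prod>i<n. 1 + fps_X ^ (2 * i + 1)) \<longlonglongrightarrow> odd_prod"
proof (rule fps_tendsto_mult_cancel)
  show "(\<lambda>n. \<Prod>i<n. 1 + fps_X ^ (2 * (i + 1))) \<longlonglongrightarrow> eulerf 4 / eulerf 2"
    using prod_one_plus_tendsto[of 2] by simp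
  show "(eulerf 4 / eulerf 2) $ 0 \<noteq> 0"
    by (simp add: fps_divide_unit eulerf_nth_0)
  have "(\<lambda>n. \<Prod>i<2 * n. 1 + fps_X ^ (i + 1)) \<longlonglongrightarrow> eulerf 2 / eulerf 1"
    using filterlim_compose[OF prod_one_plus_tendsto[of 1] filterlim_times_2] by simp
  moreover have "(\<Prod>i<n. 1 + fps_X ^ (2 * i + 1)) * (\<Prod>i<n. 1 + fps_X ^ (2 * (i + 1))) =
      (\<Prod>i<2 * n. 1 + fps_X ^ (i + 1) :: rat fps)" for n
    using prod_even_odd_split[of "\<lambda>i. 1 + fps_X ^ (i + 1) :: rat fps" n] by simp
  moreover have "odd_prod * (eulerf 4 / eulerf 2) = eulerf 2 / eulerf 1"
  proof -
    have "odd_prod * (eulerf 4 / eulerf 2) * (eulerf 1 * eulerf 2) =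
        eulerf 2 / eulerf 1 * (eulerf 1 * eulerf 2)"
    proof -
      have a: "eulerf 4 / eulerf 2 * eulerf 2 = eulerf 4" "eulerf 2 / eulerf 1 * eulerf 1 =
          eulerf 2"
        by (simp_all add: fps_divide_unit mult.assoc inverse_mult_eq_1 eulerf_nth_0)
      have "odd_prod * (eulerf 4 / eulerf 2) * (eulerf 1 * eulerf 2) =
          odd_prod * eulerf 1 * (eulerf 4 / eulerf 2 * eulerf 2)"
        by (simp only: mult_ac)
      also have "\<dots> = eulerf 2 / eulerf 1 * eulerf 1 * eulerf 2"
        unfolding a using odd_prod_mult by (simp add: power2_eq_square mult_ac)
      finally show ?thesis by (simp only: mult.assoc)
    qed
    thus ?thesis by (simp add: eulerf_nonzero)
  qed
  ultimately show "(\<lambda>n. (\<Prod>i<n. 1 + fps_X ^ (2 * i + 1)) * (\<Prod>i<n. 1 + fps_X ^ (2 * (i + 1)))) \<longlonglongrightarrow>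
      odd_prod * (eulerf 4 / eulerf 2)"
    by simp
qed

text \<open>Replacing \<open>q\<close> by \<open>-q\<close> turns the factors into
  \<open>1 - q^(2i+1)\<close>; together with the even factors from \<open>eulerf 2\<close> they make
  up \<open>eulerf 1\<close>.\<close>

lemma odd_prod_uminus: "(odd_prod oo - fps_X) * eulerf 2 = eulerf 1"
proof (rule LIMSEQ_unique)
  have "(\<lambda>n. ((\<Prod>i<n. 1 + fps_X ^ (2 * i + 1)) oo - fps_X) * qpoch (fps_X ^ 2) n) \<longlonglongrightarrow>
      (odd_prod oo - fps_X) * eulerf 2"
    by (intro fps_tendsto_mult fps_tendsto_compose prod_odd_tendsto qpoch_tendsto_eulerf) simp
  moreover have "((\<Prod>i<n. 1 + fps_X ^ (2 * i + 1)) oo - fps_X) * qpoch (fps_X ^ 2) n =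
      (qpoch fps_X (2 * n) :: rat fps)" for n
  proof -
    have "((\<Prod>i<n. 1 + fps_X ^ (2 * i + 1)) oo - fps_X) = (\<Prod>i<n. 1 - fps_X ^ (2 * i + 1) :: rat fps)"
      by (simp add: fps_compose_prod_distrib fps_compose_add_distrib fps_X_power_compose del:
          power_Suc)
    thus ?thesis
      using prod_even_odd_split[of "\<lambda>i. 1 - fps_X ^ (i + 1) :: rat fps" n]
      by (simp add: qpoch_def flip: power_mult del: power_Suc)
  qed
  ultimately show "(\<lambda>n. qpoch fps_X (2 * n)) \<longlonglongrightarrow> (odd_prod oo - fps_X) * eulerf 2"
    by simp
  show "(\<lambda>n. qpoch fps_X (2 * n)) \<longlonglongrightarrow> eulerf 1"
    using filterlim_compose[OF qpoch_tendsto_eulerf[of 1] filterlim_times_2] by simp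
qed

text \<open>Obtained by substituting \<open>-q\<close> in \<open>odd_prod_mult\<close>, where
  \<open>eulerf 2\<close> and \<open>eulerf 4\<close> are invariant.\<close>

lemma eulerf_1_uminus: "(eulerf 1 oo - fps_X) * eulerf 1 * eulerf 4 = eulerf 2 ^ 3"
proof -
  have "(odd_prod * (eulerf 1 * eulerf 4)) oo - fps_X = eulerf 2 ^ 2 oo - fps_X"
    by (simp only: odd_prod_mult)
  hence "(odd_prod oo - fps_X) * ((eulerf 1 oo - fps_X) * eulerf 4) = eulerf 2 ^ 2"
    by (simp add: fps_compose_mult_distrib eulerf_compose_uminus flip: fps_compose_power)
  hence "((odd_prod oo - fps_X) * eulerf 2) * ((eulerf 1 oo - fps_X) * eulerf 4) = eulerf 2 ^ 3"
    by (simp add: power3_eq_cube power2_eq_square mult_ac)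
  thus ?thesis unfolding odd_prod_uminus by (simp only: mult_ac)
qed

lemma theta_0_eq: "theta 0 = odd_prod ^ 2 * eulerf 2"
proof (rule LIMSEQ_unique)
  show "(\<lambda>n. (\<Prod>i<n. 1 + fps_X ^ (2 * i + 1)) * (\<Prod>i<n. 1 + fps_X ^ (2 * i + 1)) * eulerf 2) \<longlonglongrightarrow>
      theta 0"
    using triple_product_tendsto_theta[of 0] by simp
  show "(\<lambda>n. (\<Prod>i<n. 1 + fps_X ^ (2 * i + 1)) * (\<Prod>i<n. 1 + fps_X ^ (2 * i + 1)) * eulerf 2) \<longlonglongrightarrow>
      odd_prod ^ 2 * eulerf 2"
    unfolding power2_eq_square by (intro fps_tendsto_mult prod_odd_tendsto tendsto_const)
qed

lemma theta_1_mult: "theta 1 * eulerf 2 = 2 * eulerf 4 ^ 2"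
proof -
  let ?P = "\<lambda>n. \<Prod>i<n. 1 + fps_X ^ (2 * (i + 1)) :: rat fps"
  have P: "?P \<longlonglongrightarrow> eulerf 4 / eulerf 2"
    using prod_one_plus_tendsto[of 2] by simp
  have "(\<lambda>n. (\<Prod>i<Suc n. 1 + fps_X ^ (2 * i)) * ?P (Suc n) * eulerf 2) \<longlonglongrightarrow> theta 1"
    using LIMSEQ_Suc[OF triple_product_tendsto_theta[of 1]] by simp
  \<comment> \<open>For \<open>a = 1\<close> the factor at \<open>i = 0\<close> is
    \<open>1 + q^0 = 2\<close>, the source of the 2 in the result.\<close>
  moreover have "(\<Prod>i<Suc n. 1 + fps_X ^ (2 * i)) = 2 * ?P n" for n
    by (subst prod.lessThan_Suc_shift) simp
  ultimately have "(\<lambda>n. 2 * ?P n * ?P (Suc n) * eulerf 2) \<longlonglongrightarrow> theta 1"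
    by simp
  moreover have "(\<lambda>n. 2 * ?P n * ?P (Suc n) * eulerf 2) \<longlonglongrightarrow>
      2 * (eulerf 4 / eulerf 2) * (eulerf 4 / eulerf 2) * eulerf 2"
    by (intro fps_tendsto_mult P LIMSEQ_Suc[OF P] tendsto_const)
  ultimately have "theta 1 = 2 * (eulerf 4 / eulerf 2) * (eulerf 4 / eulerf 2) * eulerf 2"
    by (rule LIMSEQ_unique)
  moreover have "eulerf 4 / eulerf 2 * eulerf 2 = eulerf 4"
    by (simp add: fps_divide_unit mult.assoc inverse_mult_eq_1 eulerf_nth_0)
  ultimately show ?thesis by (simp add: power2_eq_square mult.assoc)
qed

section \<open>Squares of theta series and lattice points\<close>

text \<open>The Cauchy product read as a count of lattice points, so that identities between squares
  of theta series become bijections.\<close>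

lemma theta_square_nth:
  assumes a: "a \<in> {0, 1}"
  shows "(theta a)\<^sup>2 $ n = of_nat (card {(x :: int, y :: int). x\<^sup>2 + int a * x + (y\<^sup>2 + int a * y) =
      int n})"
proof -
  define S where "S m = {j :: int. j\<^sup>2 + int a * j = int m}" for m
  have fin: "finite (S m)" for m
  proof (rule finite_subset)
    show "S m \<subseteq> {- int m - 1..int m + 1}"
    proof
      fix j assume "j \<in> S m"
      hence "\<bar>j\<bar> \<le> int m + 1" by (intro abs_le_square_add_linear[OF a]) (simp add: S_def)
      thus "j \<in> {- int m - 1..int m + 1}" by simp linarith
    qed
  qed simp
  have "{(x :: int, y :: int). x\<^sup>2 + int a * x + (y\<^sup>2 + int a * y) = int n} =
      (\<Union>i\<in>{0..n}. S i \<times> S (n - i))" (is "?T = _")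
  proof (intro equalityI subsetI)
    fix p assume "p \<in> ?T"
    then obtain x y where p: "p = (x, y)" "x\<^sup>2 + int a * x + (y\<^sup>2 + int a * y) = int n" by auto
    moreover have "x\<^sup>2 + int a * x \<ge> 0" "y\<^sup>2 + int a * y \<ge> 0"
      using square_add_linear_nonneg[OF a] by auto
    moreover define i where "i = nat (x\<^sup>2 + int a * x)"
    ultimately have "i \<le> n" "x \<in> S i" "y \<in> S (n - i)" by (simp_all add: S_def)
    thus "p \<in> (\<Union>i\<in>{0..n}. S i \<times> S (n - i))" using p by auto
  qed (auto simp: S_def)
  moreover have "S i \<inter> S j = {}" if "i \<noteq> j" for i j
    using that by (auto simp: S_def)
  hence "card (\<Union>i\<in>{0..n}. S i \<times> S (n - i)) = (\<Sum>i=0..n. card (S i \<times> S (n - i)))"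
    by (intro card_UN_disjoint) (simp_all add: fin Times_Int_Times)
  ultimately have "card ?T = (\<Sum>i=0..n. card (S i \<times> S (n - i)))"
    by (simp only:)
  thus ?thesis
    by (simp add: power2_eq_square fps_mult_nth theta_def S_def card_cartesian_product)
qed

lemma theta_0_square: "(theta 0)\<^sup>2 = (theta 0 oo fps_X\<^sup>2)\<^sup>2 + fps_X * (theta 1 oo fps_X\<^sup>2)\<^sup>2"
proof (rule fps_ext)
  fix n
  show "(theta 0)\<^sup>2 $ n = ((theta 0 oo fps_X\<^sup>2)\<^sup>2 + fps_X * (theta 1 oo fps_X\<^sup>2)\<^sup>2) $ n"
  proof (cases "even n")
    case True
    then obtain m where m: "n = 2 * m" by blast
    have "bij_betw (\<lambda>(u, v). (u + v, u - v)) {(x :: int, y :: int). x\<^sup>2 + y\<^sup>2 = int m}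
        {(x, y). x\<^sup>2 + y\<^sup>2 = int n}"
    proof (rule bij_betw_byWitness[where f' = "\<lambda>(x, y). ((x + y) div 2, (x - y) div 2)"])
      show "(\<lambda>(x :: int, y). ((x + y) div 2, (x - y) div 2)) ` {(x, y). x\<^sup>2 + y\<^sup>2 = int n} \<subseteq>
          {(x, y). x\<^sup>2 + y\<^sup>2 = int m}"
      proof clarsimp
        fix x y :: int assume h: "x\<^sup>2 + y\<^sup>2 = int n"
        hence "even (x\<^sup>2 + y\<^sup>2)" by (simp add: m)
        hence "even (x + y)" by simp
        then obtain u where "x + y = 2 * u" by blast
        hence x: "x = 2 * u - y" by simp
        have "((x + y) div 2) = u" "(x - y) div 2 = u - y" unfolding x by simp_all
        thus "((x + y) div 2)\<^sup>2 + ((x - y) div 2)\<^sup>2 = int m"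
          using h unfolding m x by (simp add: power2_eq_square algebra_simps)
      qed
      show "\<forall>p\<in>{(x :: int, y). x\<^sup>2 + y\<^sup>2 = int n}. (\<lambda>(u, v). (u + v, u - v)) ((\<lambda>(x, y). ((x + y) div
          2, (x - y) div 2)) p) = p"
      proof clarsimp
        fix x y :: int assume h: "x\<^sup>2 + y\<^sup>2 = int n"
        hence "even (x\<^sup>2 + y\<^sup>2)" by (simp add: m)
        hence "even (x + y)" by simp
        thus "(x + y) div 2 + (x - y) div 2 = x \<and> (x + y) div 2 - (x - y) div 2 = y" by presburger
      qed
    qed (auto simp: m power2_eq_square algebra_simps)
    hence "card {(x :: int, y :: int). x\<^sup>2 + y\<^sup>2 = int n} = card {(x :: int, y :: int). x\<^sup>2 + y\<^sup>2 =
        int m}"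
      by (rule bij_betw_same_card [symmetric])
    hence "(theta 0)\<^sup>2 $ n = (theta 0)\<^sup>2 $ m" by (simp add: theta_square_nth)
    moreover have "(fps_X * (theta 1 oo fps_X\<^sup>2)\<^sup>2) $ n = 0"
      using True by (auto simp: fps_compose_power fps_nth_compose_X_power)
    ultimately show ?thesis
      by (simp add: fps_compose_power fps_nth_compose_X_power m)
  next
    case False
    then obtain m where m: "n = 2 * m + 1" using oddE by blast
    \<comment> \<open>Here \<open>x + y\<close> and \<open>x - y\<close> are odd, and
      \<open>(u + v + 1)^2 + (u - v)^2 = 2 * (u^2 + u + v^2 + v) + 1\<close>. In the inverse map
      \<open>div\<close> rounds down, which absorbs the shift by 1.\<close>
    have "bij_betw (\<lambda>(u, v). (u + v + 1, u - v)) {(x :: int, y :: int). x\<^sup>2 + x + (y\<^sup>2 + y) = int m}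
        {(x, y). x\<^sup>2 + y\<^sup>2 = int n}"
    proof (rule bij_betw_byWitness[where f' = "\<lambda>(x, y). ((x + y) div 2, (x - y) div 2)"])
      show "(\<lambda>(x :: int, y). ((x + y) div 2, (x - y) div 2)) ` {(x, y). x\<^sup>2 + y\<^sup>2 = int n} \<subseteq>
          {(x, y). x\<^sup>2 + x + (y\<^sup>2 + y) = int m}"
      proof clarsimp
        fix x y :: int assume h: "x\<^sup>2 + y\<^sup>2 = int n"
        hence "odd (x\<^sup>2 + y\<^sup>2)" by (simp add: m)
        hence "odd (x + y)" by simp
        then obtain u where "x + y = 2 * u + 1" using oddE by blast
        hence x: "x = 2 * u + 1 - y" by simp
        have e: "((x + y) div 2) = u" "(x - y) div 2 = u - y" unfolding x by simp_all
        show "((x + y) div 2)\<^sup>2 + (x + y) div 2 + (((x - y) div 2)\<^sup>2 + (x - y) div 2) = int m"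
          unfolding e using h unfolding m x by (simp add: power2_eq_square algebra_simps)
      qed
      show "\<forall>p\<in>{(x :: int, y). x\<^sup>2 + y\<^sup>2 = int n}. (\<lambda>(u, v). (u + v + 1, u - v)) ((\<lambda>(x, y). ((x + y)
          div 2, (x - y) div 2)) p) = p"
      proof clarsimp
        fix x y :: int assume h: "x\<^sup>2 + y\<^sup>2 = int n"
        hence "odd (x\<^sup>2 + y\<^sup>2)" by (simp add: m)
        hence "odd (x + y)" by simp
        thus "(x + y) div 2 + (x - y) div 2 + 1 = x \<and> (x + y) div 2 - (x - y) div 2 = y"
            by presburger
      qed
    qed (auto simp: m power2_eq_square algebra_simps)
    hence "card {(x :: int, y :: int). x\<^sup>2 + y\<^sup>2 = int n} = card
        {(x :: int, y :: int). x\<^sup>2 + x + (y\<^sup>2 + y) = int m}"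
      by (rule bij_betw_same_card [symmetric])
    hence "(theta 0)\<^sup>2 $ n = (theta 1)\<^sup>2 $ m" by (simp add: theta_square_nth)
    thus ?thesis
      by (simp add: fps_compose_power fps_nth_compose_X_power m)
  qed
qed

section \<open>Jacobi's identity\<close>

lemma theta_0_mult: "theta 0 * (eulerf 1 ^ 2 * eulerf 4 ^ 2) = eulerf 2 ^ 5"
proof -
  have "theta 0 * (eulerf 1 ^ 2 * eulerf 4 ^ 2) = (odd_prod * (eulerf 1 * eulerf 4)) ^ 2 * eulerf 2"
    by (simp add: theta_0_eq power_mult_distrib mult_ac)
  also have "\<dots> = eulerf 2 ^ 5" unfolding odd_prod_mult by (simp flip: power_mult power_Suc2)
  finally show ?thesis .
qed

text \<open>The classical \<open>\<phi>(-q) = f1^2 / f2\<close> with the sign of \<open>q\<close>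
  reversed; it follows by cancelling \<open>f1^2 * f4^2\<close>.\<close>

lemma theta_0_eulerf_2: "theta 0 * eulerf 2 = (eulerf 1 oo - fps_X) ^ 2"
proof -
  have "theta 0 * (eulerf 1 ^ 2 * eulerf 4 ^ 2) * eulerf 2 = (eulerf 2 ^ 3) ^ 2"
    unfolding theta_0_mult by (simp flip: power_mult power_Suc2)
  also have "\<dots> = (eulerf 1 oo - fps_X) ^ 2 * (eulerf 1 ^ 2 * eulerf 4 ^ 2)"
    unfolding eulerf_1_uminus [symmetric] by (simp add: power_mult_distrib mult_ac)
  finally have "(theta 0 * eulerf 2) * (eulerf 1 ^ 2 * eulerf 4 ^ 2) =
      (eulerf 1 oo - fps_X) ^ 2 * (eulerf 1 ^ 2 * eulerf 4 ^ 2)"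
    by (simp only: mult_ac)
  thus ?thesis by (simp add: eulerf_nonzero)
qed

lemma fps_compose_uminus_X_involutive: "((F :: 'a :: idom fps) oo - fps_X) oo - fps_X = F"
  by (rule fps_ext) (simp add: fps_compose_uminus' flip: mult.assoc power_add)

text \<open>\<open>A\<close> and \<open>B\<close> are even series, so \<open>-q\<close> only flips
  the sign of \<open>X * B^2\<close>. Hence \<open>T^4 - T'^4\<close> is \<open>2 * A^2\<close>
  times \<open>2 * X * B^2\<close>, and in the product \<open>A * B\<close> the factors
  \<open>eulerf 8\<close> cancel.\<close>

lemma jacobi_abstruse: "(eulerf 1 oo - fps_X) ^ 8 - eulerf 1 ^ 8 = 16 * fps_X * eulerf 4 ^ 8"
proof -
  define T T' A B where "T = theta 0" "T' = theta 0 oo - fps_X" 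
    "A = theta 0 oo fps_X\<^sup>2" "B = theta 1 oo fps_X\<^sup>2"
  note defs = this
  have even: "(F oo fps_X\<^sup>2) oo - fps_X = F oo fps_X\<^sup>2" for F :: "rat fps"
    by (rule fps_ext) (simp add: fps_compose_uminus' fps_nth_compose_X_power)
  have T: "T\<^sup>2 = A\<^sup>2 + fps_X * B\<^sup>2"
    unfolding defs by (rule theta_0_square)
  have "(theta 0)\<^sup>2 oo - fps_X = ((theta 0 oo fps_X\<^sup>2)\<^sup>2 + fps_X * (theta 1 oo fps_X\<^sup>2)\<^sup>2) oo - fps_X"
    by (simp only: theta_0_square)
  hence T': "T'\<^sup>2 = A\<^sup>2 - fps_X * B\<^sup>2"
    unfolding defs
    by (simp add: fps_compose_add_distrib fps_compose_mult_distrib even flip: fps_compose_power)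
  have A: "A * (eulerf 2 ^ 2 * eulerf 8 ^ 2) = eulerf 4 ^ 5"
    using arg_cong[OF theta_0_mult, of "\<lambda>F. F oo fps_X\<^sup>2"]
    by (simp add: defs fps_compose_mult_distrib eulerf_compose_square flip: fps_compose_power)
  have B: "B * eulerf 4 = 2 * eulerf 8 ^ 2"
    using arg_cong[OF theta_1_mult, of "\<lambda>F. F oo fps_X\<^sup>2"]
    by (simp add: defs fps_compose_mult_distrib eulerf_compose_square flip: fps_compose_power)
  have "(A * B * eulerf 2 ^ 2) * (eulerf 8 ^ 2 * eulerf 4) =
      (2 * eulerf 4 ^ 4) * (eulerf 8 ^ 2 * eulerf 4)"
  proof -
    have "(A * B * eulerf 2 ^ 2) * (eulerf 8 ^ 2 * eulerf 4) =
        (A * (eulerf 2 ^ 2 * eulerf 8 ^ 2)) * (B * eulerf 4)"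
      by (simp only: mult_ac)
    also have "\<dots> = (2 * eulerf 4 ^ 4) * (eulerf 8 ^ 2 * eulerf 4)"
      unfolding A B by (simp add: mult_ac flip: power_Suc)
    finally show ?thesis .
  qed
  hence AB: "A * B * eulerf 2 ^ 2 = 2 * eulerf 4 ^ 4" by (simp add: eulerf_nonzero)
  have t: "T * eulerf 2 = (eulerf 1 oo - fps_X) ^ 2"
    unfolding defs by (rule theta_0_eulerf_2)
  have t': "T' * eulerf 2 = eulerf 1 ^ 2"
    using arg_cong[OF theta_0_eulerf_2, of "\<lambda>F. F oo - fps_X"]
    by (simp add: defs fps_compose_mult_distrib eulerf_compose_uminus
        fps_compose_uminus_X_involutive flip: fps_compose_power)
  have "(eulerf 1 oo - fps_X) ^ 8 - eulerf 1 ^ 8 = (T * eulerf 2) ^ 4 - (T' * eulerf 2) ^ 4"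
    unfolding t t' by (simp flip: power_mult)
  also have "\<dots> = (T\<^sup>2 + T'\<^sup>2) * (T\<^sup>2 - T'\<^sup>2) * eulerf 2 ^ 4" by algebra
  also have "\<dots> = 4 * fps_X * (A * B * eulerf 2 ^ 2)\<^sup>2" unfolding T T' by algebra
  also have "\<dots> = 16 * fps_X * eulerf 4 ^ 8" unfolding AB by algebra
  finally show ?thesis .
qed

section \<open>Extraction of odd parts and the two formulas\<close>

text \<open>\<open>F(q) - F(-q)\<close> is twice the odd part of \<open>F\<close>, so dissecting a
  series reduces to an identity between series.\<close>

lemma odd_part_eqI:
  fixes F H :: "rat fps"
  assumes "F - (F oo - fps_X) = 2 * fps_X * (H oo fps_X\<^sup>2)"
  shows "Abs_fps (\<lambda>n. F $ (2 * n + 1)) = H"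
proof (rule fps_ext)
  fix n
  have "(F - (F oo - fps_X)) $ (2 * n + 1) = (2 * (fps_X * (H oo fps_X\<^sup>2))) $ (2 * n + 1)"
    using assms by (simp add: mult.assoc)
  hence "2 * F $ (2 * n + 1) = 2 * H $ n"
    by (simp add: fps_compose_uminus' fps_nth_compose_X_power fps_numeral_fps_const del:
        numeral_fps_const)
  thus "Abs_fps (\<lambda>n. F $ (2 * n + 1)) $ n = H $ n" by simp
qed

theorem theorem3p1:
  shows "Abs_fps (\<lambda>n. p8 (2 * n + 1)) = 8 * (eulerf 2 ^ 16 / eulerf 1 ^ 24)
    \<and> Abs_fps (\<lambda>n. p8 (4 * n + 3)) =
        192 * (eulerf 2 ^ 24 / eulerf 1 ^ 32)
        + 16384 * fps_X * (eulerf 2 ^ 48 / eulerf 1 ^ 56)"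
proof -
  define i1 i2 g G G' where "i1 = inverse (eulerf 1)" "i2 = inverse (eulerf 2)" 
    "g = eulerf 1 oo - fps_X" "G = i1 ^ 8" "G' = G oo - fps_X"
  note defs = this
  have i1: "i1 * eulerf 1 = 1" and i2: "i2 * eulerf 2 = 1"
    by (simp_all add: defs inverse_mult_eq_1 eulerf_nth_0)
  have div: "F / eulerf 1 ^ n = F * i1 ^ n" for F n
    by (simp add: fps_divide_unit eulerf_nth_0 defs fps_inverse_power)
  have i1_sq: "i1 oo fps_X\<^sup>2 = i2" "i2 oo - fps_X = i2"
    by (simp_all add: defs fps_inverse_compose eulerf_nth_0 eulerf_compose_square
        eulerf_compose_uminus)
  have gf: "g * eulerf 1 * eulerf 4 = eulerf 2 ^ 3"
    unfolding defs by (rule eulerf_1_uminus)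
  have G: "G * eulerf 1 ^ 8 = 1" using i1 by (simp add: defs flip: power_mult_distrib)
  have G': "G' * g ^ 8 = 1"
    using arg_cong[OF G, of "\<lambda>F. F oo - fps_X"] by (simp add: defs fps_compose_mult_distrib
        flip: fps_compose_power)
  have jac: "g ^ 8 - eulerf 1 ^ 8 = 16 * fps_X * eulerf 4 ^ 8"
    unfolding defs by (rule jacobi_abstruse)
  have GG: "G * G' = eulerf 4 ^ 8 * i2 ^ 24"
  proof -
    \<comment> \<open>Inserting \<open>1 = (i2 * eulerf 2) ^ 24\<close> makes
      \<open>eulerf 2 ^ 24 = (g * eulerf 1 * eulerf 4) ^ 8\<close> available.\<close>
    have "G * G' = G * G' * (i2 * eulerf 2) ^ 24" by (simp add: i2)
    also have "\<dots> = G * G' * i2 ^ 24 * (eulerf 2 ^ 3) ^ 8"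
      by (simp add: power_mult_distrib flip: power_mult)
    also have "\<dots> = (G * eulerf 1 ^ 8) * (G' * g ^ 8) * eulerf 4 ^ 8 * i2 ^ 24"
      unfolding gf [symmetric] power_mult_distrib by (simp only: mult_ac)
    finally show ?thesis unfolding G G' by simp
  qed
  have D: "G - G' = 16 * fps_X * eulerf 4 ^ 16 * i2 ^ 24"
  proof -
    have "G - G' = G * G' * (g ^ 8 - eulerf 1 ^ 8)" using G G'
        by (simp add: right_diff_distrib mult_ac)
    thus ?thesis unfolding jac GG by (simp add: mult_ac flip: power_add)
  qed
  define H where "H = eulerf 2 ^ 16 * i1 ^ 24"
  have p8: "p8 n = G $ n" for n unfolding p8_def div by (simp add: defs)
  have first: "Abs_fps (\<lambda>n. G $ (2 * n + 1)) = 8 * H"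
  proof (rule odd_part_eqI)
    show "G - (G oo - fps_X) = 2 * fps_X * ((8 * H) oo fps_X\<^sup>2)"
      using D by (simp add: defs(5) H_def fps_compose_mult_distrib i1_sq eulerf_compose_square
          flip: fps_compose_power)
  qed
  \<comment> \<open>As \<open>4 * n + 3 = 2 * (2 * n + 1) + 1\<close>, the second series is the odd
    part of the first. Since \<open>H = eulerf 2 ^ 16 * G ^ 3\<close> and \<open>eulerf 2\<close> is
    even, the difference to be computed is a multiple of \<open>G ^ 3 - G' ^ 3\<close>.\<close>
  have second: "Abs_fps (\<lambda>n. (8 * H) $ (2 * n + 1)) = 
      192 * (eulerf 2 ^ 24 * i1 ^ 32) + 16384 * fps_X * (eulerf 2 ^ 48 * i1 ^ 56)" (is "_ = ?R")
  proof (rule odd_part_eqI)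
    have "(8 * H) oo - fps_X = 8 * (eulerf 2 ^ 16 * G' ^ 3)"
      by (simp add: H_def defs fps_compose_mult_distrib eulerf_compose_uminus
          flip: fps_compose_power power_mult)
    moreover have "8 * H = 8 * (eulerf 2 ^ 16 * G ^ 3)"
      by (simp add: H_def defs flip: power_mult)
    ultimately have "8 * H - (8 * H oo - fps_X) =
        8 * eulerf 2 ^ 16 * (G - G') * ((G - G')\<^sup>2 + 3 * (G * G'))"
      by algebra
    also have "\<dots> = 2 * fps_X * (192 * (eulerf 4 ^ 24 * i2 ^ 32) + 16384 * fps_X\<^sup>2 * (eulerf 4 ^ 48 *
        i2 ^ 56))"
    proof -
      have "eulerf 2 ^ 16 * i2 ^ 24 = (i2 * eulerf 2) ^ 16 * i2 ^ 8"
        unfolding power_mult_distrib by (simp add: mult_ac flip: power_add)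
      hence c: "eulerf 2 ^ 16 * i2 ^ 24 = i2 ^ 8" by (simp add: i2)
      \<comment> \<open>The constants arise as \<open>8 * 16 * 3 = 2 * 192\<close> and
        \<open>8 * 16 * 256 = 2 * 16384\<close>.\<close>
      have "8 * eulerf 2 ^ 16 * (G - G') * ((G - G')\<^sup>2 + 3 * (G * G')) =
          128 * (eulerf 2 ^ 16 * i2 ^ 24) * fps_X * eulerf 4 ^ 16 *
          (256 * fps_X\<^sup>2 * eulerf 4 ^ 32 * i2 ^ 48 + 3 * (eulerf 4 ^ 8 * i2 ^ 24))"
        unfolding D GG by (simp add: power_mult_distrib flip: power_mult)
      also have "\<dots> = 2 * fps_X * (192 * (eulerf 4 ^ 24 * i2 ^ 32) + 16384 * fps_X\<^sup>2 * (eulerf 4 ^ 48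
          * i2 ^ 56))"
        unfolding c by (simp add: algebra_simps flip: power_add)
      finally show ?thesis .
    qed
    finally show "8 * H - (8 * H oo - fps_X) = 2 * fps_X * (?R oo fps_X\<^sup>2)"
      by (simp add: fps_compose_mult_distrib fps_compose_add_distrib i1_sq eulerf_compose_square
          flip: fps_compose_power)
  qed
  have "p8 (4 * n + 3) = (8 * H) $ (2 * n + 1)" for n
  proof -
    have "(8 * H) $ (2 * n + 1) = G $ (2 * (2 * n + 1) + 1)" unfolding first [symmetric] by simp
    also have "2 * (2 * n + 1) + 1 = 4 * n + 3" by simp
    finally show ?thesis by (simp only: p8)
  qed
  thus ?thesis unfolding div using first second by (simp add: p8 H_def)
qed

end
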